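(* For all matrices $K\in\mathbb R^{N\times N}$, $K$ is admissible if and only if $(-1)^{|J|}\det(K-\mathbf 1_J)\geq 0$ for all $J\subseteq[N]$.
   Context: $[N]=\{1,\dots,N\}$. For $K\in\mathbb R^{N\times N}$ and $J\subseteq[N]$, $K_J=(K_{i,j})_{i,j\in J}$, with $\det(K_\emptyset)=1$. A determinantal point process (DPP) on $[N]$ with kernel $K\in\mathbb R^{N\times N}$ (not necessarily symmetric) is a random subset $Y\subseteq[N]$ such that $\mathbb P[J\subseteq Y]=\det(K_J)$ for all $J\subseteq[N]$. A matrix $K\in\mathbb R^{N\times N}$ is called admissible if there exists a DPP with kernel $K$. For $J\subseteq[N]$, $\mathbf 1_J$ is the $N\times N$ diagonal matrix whose $j$-th diagonal entry is $1$ if $j\in J$ and $0$ otherwise. *)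

theory Defs
  imports "HOL-Probability.Probability" "Jordan_Normal_Form.Determinant" "Jordan_Normal_Form.DL_Submatrix"
begin

text \<open>
  Matrices are indexed from 0, so the ground set \<open>[N] = {1, ..., N}\<close> is represented by
  \<open>{0..<N}\<close>, and the principal submatrix \<open>K\<^sub>J\<close> is \<open>submatrix K J J\<close>. For \<open>J = {}\<close> it is the
  0-by-0 matrix, whose determinant is 1.
\<close>

definition is_dpp :: "nat \<Rightarrow> real mat \<Rightarrow> 'a measure \<Rightarrow> ('a \<Rightarrow> nat set) \<Rightarrow> bool" where
  "is_dpp N K M Y \<longleftrightarrow>
     prob_space M \<and>
     Y \<in> measurable M (count_space (Pow {0..<N})) \<and>
     (\<forall>J \<subseteq> {0..<N}. measure M {\<omega> \<in> space M. J \<subseteq> Y \<omega>} = det (submatrix K J J))"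

text \<open>
  HOL cannot quantify existentially over the type of the sample space, so it is fixed to be
  \<^typ>\<open>nat set\<close>. This loses no generality: lemma \<open>is_dpp_imp_admissible\<close> below passes from an
  arbitrary sample space to the law of the process.
\<close>

definition admissible :: "nat \<Rightarrow> real mat \<Rightarrow> bool" where
  "admissible N K \<longleftrightarrow> (\<exists>(M :: nat set measure) Y. is_dpp N K M Y)"

definition diag_ind :: "nat \<Rightarrow> nat set \<Rightarrow> real mat" where
  "diag_ind N J = mat N N (\<lambda>(i, j). if i = j \<and> j \<in> J then 1 else 0)"

lemma det_submatrix_empty: "det (submatrix (K :: real mat) {} {}) = 1"
proof -
  have "submatrix K {} {} \<in> carrier_mat 0 0"
    by (intro carrier_matI) (simp_all add: dim_submatrix)
  then show ?thesis by simp
qed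

lemma is_dpp_imp_admissible:
  assumes "is_dpp N K M Y"
  shows "admissible N K"
proof -
  let ?S = "count_space (Pow {0..<N})"
  let ?M = "distr M ?S Y"
  have p: "prob_space M" and Y: "Y \<in> measurable M ?S"
    and d: "\<And>J. J \<subseteq> {0..<N} \<Longrightarrow>
      measure M {\<omega> \<in> space M. J \<subseteq> Y \<omega>} = det (submatrix K J J)"
    using assms by (auto simp: is_dpp_def)
  have "measure ?M {\<omega> \<in> space ?M. J \<subseteq> \<omega>} = det (submatrix K J J)"
    if J: "J \<subseteq> {0..<N}" for J
  proof -
    have "Y -` {\<omega> \<in> Pow {0..<N}. J \<subseteq> \<omega>} \<inter> space M = {\<omega> \<in> space M. J \<subseteq> Y \<omega>}"
      using measurable_space[OF Y] by auto
    moreover have "measure ?M {\<omega> \<in> Pow {0..<N}. J \<subseteq> \<omega>} =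
        measure M (Y -` {\<omega> \<in> Pow {0..<N}. J \<subseteq> \<omega>} \<inter> space M)"
      by (rule measure_distr[OF Y]) auto
    ultimately show ?thesis using d[OF J] by simp
  qed
  moreover have "(\<lambda>\<omega>. \<omega>) \<in> measurable ?M ?S"
    by (simp add: measurable_def)
  ultimately have "is_dpp N K ?M (\<lambda>\<omega>. \<omega>)"
    using prob_space.prob_space_distr[OF p Y] by (auto simp: is_dpp_def)
  then show ?thesis unfolding admissible_def by blast
qed

end

theory Submission imports Defs begin

text \<open>
  For disjoint \<open>A, J \<subseteq> [N]\<close> let \<open>f A J\<close> be the determinant of
  the matrix \<open>mixed_mat N K A J\<close> whose \<open>i\<close>-th row is \<open>e\<^sub>i -
  K\<^sub>i\<close> for \<open>i \<in> J\<close>, the unit vector \<open>e\<^sub>i\<close> for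
  \<open>i \<in> A\<close>, and the row \<open>K\<^sub>i\<close> of \<open>K\<close> otherwise, and
  let \<open>g A J\<close>, which is \<open>pattern_measure\<close> below, be the probability that
  \<open>Y\<close> contains \<open>[N] - A - J\<close> and avoids \<open>J\<close>. So a row
  \<open>K\<^sub>i\<close> corresponds to the requirement \<open>i \<in> Y\<close>, a row
  \<open>e\<^sub>i - K\<^sub>i\<close> to \<open>i \<notin> Y\<close>, and a row
  \<open>e\<^sub>i\<close> to no requirement on \<open>i\<close> at all. Both functions obey the
  same splitting law: releasing the requirement on \<open>i\<close> adds up the two ways of imposing
  one. For \<open>g\<close> this is additivity of the measure, and for \<open>f\<close> it is
  additivity of the determinant in row \<open>i\<close>, as \<open>e\<^sub>i = K\<^sub>i +
  (e\<^sub>i - K\<^sub>i)\<close>.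

  A function with this splitting law is determined by its values at \<open>J = {}\<close>, and also
  by its values at \<open>A = {}\<close> (\<open>splitting_eqI_no_avoided\<close> and
  \<open>splitting_eqI_no_free\<close>). Now \<open>f A {} = det K\<^sub>S\<close> with \<open>S =
  [N] - A\<close>, whereas \<open>g A {}\<close> is the probability that \<open>S \<subseteq>
  Y\<close>; so \<open>Y\<close> is a determinantal process with kernel \<open>K\<close> iff
  \<open>f = g\<close> at \<open>J = {}\<close>. On the other side \<open>f {} J =
  (-1)\<^bsup>|J|\<^esup> det (K - 1\<^sub>J)\<close>, whereas \<open>g {} J\<close> is the point
  probability of \<open>Y = [N] - J\<close>. Hence the numbers \<open>(-1)\<^bsup>|J|\<^esup> det (K
  - 1\<^sub>J)\<close> are precisely the only possible point probabilities of such a process, and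
  they define one as soon as they are nonnegative. That they sum to \<open>1\<close> is again the
  splitting law, because \<open>f [N] {}\<close> is the determinant of the identity.
\<close>

section \<open>Permutations and principal minors\<close>

lemma sign_map_permutation:
  assumes "p permutes A" "finite A" "inj_on f A"
  shows "sign (map_permutation A f p) = sign p"
  using assms(1,2)
proof (induction rule: permutes_induct)
  case id
  then show ?case using map_permutation_id'[OF assms(3)] by (metis sign_id)
next
  case (swap a b p)
  have ne: "f a \<noteq> f b"
    using swap assms(3) by (auto dest: inj_onD)
  have "map_permutation A f p permutes f ` A"
    using swap.hyps assms(3) by (intro map_permutation_permutes) (auto simp: bij_betw_def)
  then have perm: "permutation (map_permutation A f p)" "permutation p"
    using assms(2) swap.hyps by (auto simp: permutation_permutes)
  have "sign (map_permutation A f (Transposition.transpose a b \<circ> p)) =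
      sign (Transposition.transpose (f a) (f b) \<circ> map_permutation A f p)"
    by (simp only: map_permutation_compose'[OF assms(3) swap.hyps(4)]
        map_permutation_transpose[OF assms(3) swap.hyps(1,2)])
  also have "\<dots> = sign (Transposition.transpose a b \<circ> p)"
    using ne swap.hyps(3) swap.IH
    by (simp only: sign_compose[OF permutation_swap_id perm(1)]
        sign_compose[OF permutation_swap_id perm(2)] sign_swap_id if_False)
  finally show ?case .
qed

lemma bij_betw_pick:
  assumes "finite S"
  shows "bij_betw (pick S) {0..<card S} S"
proof -
  have "inj_on (pick S) {0..<card S}"
    by (rule inj_on_inverseI[where g = "\<lambda>i. card {a \<in> S. a < i}"]) (simp add: card_pick_le)
  moreover have "pick S ` {0..<card S} \<subseteq> S"
    by (auto intro: pick_in_set_le)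
  ultimately show ?thesis
    using assms by (simp add: bij_betw_def card_image card_subset_eq)
qed

text \<open>
  The enumeration of \<open>S\<close> turns the permutations of the index range of the submatrix into those
  of \<open>S\<close> itself, with the same signs.
\<close>

lemma det_principal_submatrix:
  fixes K :: "'a :: comm_ring_1 mat"
  assumes K: "K \<in> carrier_mat N N" and S: "S \<subseteq> {0..<N}"
  shows "det (submatrix K S S) =
    (\<Sum>p | p permutes S. signof p * (\<Prod>i\<in>S. K $$ (i, p i)))"
proof -
  let ?R = "{0..<card S}"
  have fin: "finite S" using S finite_subset by blast
  have bij: "bij_betw (pick S) ?R S" by (rule bij_betw_pick[OF fin])
  then have inj: "inj_on (pick S) ?R" by (rule bij_betw_imp_inj_on)
  have bij': "bij_betw (inv_into ?R (pick S)) S ?R" by (rule bij_betw_inv_into[OF bij])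
  have rows: "{i. i < N \<and> i \<in> S} = S" using S by auto
  have carrier: "submatrix K S S \<in> carrier_mat (card S) (card S)"
    using K by (intro carrier_matI) (simp_all add: dim_submatrix rows)
  have entry: "submatrix K S S $$ (i, j) = K $$ (pick S i, pick S j)"
    if "i \<in> ?R" "j \<in> ?R" for i j
    using that K by (subst submatrix_index) (simp_all add: rows)
  have "(\<Sum>p | p permutes ?R. signof p * (\<Prod>i = 0..<card S. submatrix K S S $$ (i, p i))) =
    (\<Sum>p | p permutes S. signof p * (\<Prod>i\<in>S. K $$ (i, p i)))"
  proof (rule sum.reindex_bij_witness[where
        j = "map_permutation ?R (pick S)" and i = "map_permutation S (inv_into ?R (pick S))"])
    fix p assume "p \<in> {p. p permutes ?R}"
    then have p: "p permutes ?R" by simp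
    show "map_permutation S (inv_into ?R (pick S)) (map_permutation ?R (pick S) p) = p"
      by (rule map_permutation_compose_inv[OF bij p]) (simp add: inv_into_f_f[OF inj])
    show "map_permutation ?R (pick S) p \<in> {p. p permutes S}"
      using map_permutation_permutes[OF bij p] by simp
    have "(\<Prod>i\<in>S. K $$ (i, map_permutation ?R (pick S) p i)) =
      (\<Prod>i\<in>?R. K $$ (pick S i, map_permutation ?R (pick S) p (pick S i)))"
      by (rule prod.reindex_bij_betw[OF bij, symmetric])
    also have "\<dots> = (\<Prod>i\<in>?R. submatrix K S S $$ (i, p i))"
      using permutes_in_image[OF p]
      by (intro prod.cong refl) (simp add: map_permutation_apply[OF inj] entry)
    finally show "signof (map_permutation ?R (pick S) p) *
        (\<Prod>i\<in>S. K $$ (i, map_permutation ?R (pick S) p i)) =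
      signof p * (\<Prod>i = 0..<card S. submatrix K S S $$ (i, p i))"
      by (simp add: sign_map_permutation[OF p _ inj])
  next
    fix q assume "q \<in> {q. q permutes S}"
    then have q: "q permutes S" by simp
    show "map_permutation ?R (pick S) (map_permutation S (inv_into ?R (pick S)) q) = q"
      using bij by (intro map_permutation_compose_inv[OF bij' q])
        (simp add: bij_betw_inv_into_right)
    show "map_permutation S (inv_into ?R (pick S)) q \<in> {p. p permutes ?R}"
      using map_permutation_permutes[OF bij' q] by simp
  qed
  then show ?thesis by (simp add: det_def'[OF carrier])
qed

text \<open>
  A unit row forces every permutation that contributes to the Leibniz formula to fix its index.
\<close>

lemma det_unit_rows_eq_principal_minor:
  fixes K :: "'a :: comm_ring_1 mat"
  assumes K: "K \<in> carrier_mat N N" and S: "S \<subseteq> {0..<N}"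
  shows "det (mat N N (\<lambda>(i, j). if i \<in> S then K $$ (i, j) else of_bool (i = j))) =
    det (submatrix K S S)"
proof -
  let ?M = "mat N N (\<lambda>(i, j). if i \<in> S then K $$ (i, j) else of_bool (i = j))"
  let ?t = "\<lambda>p. signof p * (\<Prod>i = 0..<N. ?M $$ (i, p i))"
  have "det ?M = (\<Sum>p | p permutes {0..<N}. ?t p)"
    by (rule det_def') simp
  also have "\<dots> = (\<Sum>p | p permutes S. ?t p)"
  proof (rule sum.mono_neutral_right)
    show "finite {p. p permutes {0..<N}}" by (simp add: finite_permutations)
    show "{p. p permutes S} \<subseteq> {p. p permutes {0..<N}}"
      using S permutes_subset by blast
    show "\<forall>p\<in>{p. p permutes {0..<N}} - {p. p permutes S}. ?t p = 0"
    proof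
      fix p assume p: "p \<in> {p. p permutes {0..<N}} - {p. p permutes S}"
      then obtain i where i: "i \<in> {0..<N} - S" "p i \<noteq> i"
        using permutes_superset[of p "{0..<N}" S] by blast
      moreover have "p i < N"
        using p i permutes_in_image[of p "{0..<N}" i] by auto
      ultimately have "?M $$ (i, p i) = 0" by auto
      then have "(\<Prod>i = 0..<N. ?M $$ (i, p i)) = 0"
        using i by (intro prod_zero) auto
      then show "?t p = 0" by simp
    qed
  qed
  also have "\<dots> = (\<Sum>p | p permutes S. signof p * (\<Prod>i\<in>S. K $$ (i, p i)))"
  proof (intro sum.cong refl)
    fix p assume "p \<in> {p. p permutes S}"
    then have p: "p permutes S" by simp
    have lt: "p i < N" if "i < N" for i
      using permutes_in_image[OF permutes_subset[OF p S], of i] that by simp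
    have "(\<Prod>i = 0..<N. ?M $$ (i, p i)) = (\<Prod>i\<in>S. ?M $$ (i, p i))"
      using S lt permutes_not_in[OF p] by (intro prod.mono_neutral_right) auto
    also have "\<dots> = (\<Prod>i\<in>S. K $$ (i, p i))"
      using S lt by (intro prod.cong) auto
    finally show "?t p = signof p * (\<Prod>i\<in>S. K $$ (i, p i))" by simp
  qed
  also have "\<dots> = det (submatrix K S S)"
    by (rule det_principal_submatrix[OF K S, symmetric])
  finally show ?thesis .
qed

section \<open>Functions with the splitting law\<close>

definition splitting :: "'i set \<Rightarrow> ('i set \<Rightarrow> 'i set \<Rightarrow> 'a :: ab_group_add) \<Rightarrow> bool" where
  "splitting U f \<longleftrightarrow> (\<forall>A J i. insert i (A \<union> J) \<subseteq> U \<and> i \<notin> A \<union> J \<and> A \<inter> J = {} \<longrightarrow>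
     f (insert i A) J = f A J + f A (insert i J))"

lemma splittingD:
  assumes "splitting U f" "insert i (A \<union> J) \<subseteq> U" "i \<notin> A \<union> J" "A \<inter> J = {}"
  shows "f (insert i A) J = f A J + f A (insert i J)"
  using assms unfolding splitting_def by blast

text \<open>
  The splitting law, solved for its last term, moves an element out of \<open>J\<close>.
\<close>

lemma splitting_eqI_no_avoided:
  assumes U: "finite U" and f: "splitting U f" and g: "splitting U g"
    and eq: "\<And>A. A \<subseteq> U \<Longrightarrow> f A {} = g A {}"
    and A: "A \<subseteq> U" and J: "J \<subseteq> U" "A \<inter> J = {}"
  shows "f A J = g A J"
proof -
  have "finite J" using J U finite_subset by blast
  then show ?thesis using A J
  proof (induction J arbitrary: A)
    case empty
    then show ?case by (simp add: eq)
  next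
    case (insert i J)
    have "f A J + f A (insert i J) = g A J + g A (insert i J)"
      using insert.IH[of "insert i A"] insert.prems insert.hyps
        splittingD[OF f, of i A J] splittingD[OF g, of i A J] by auto
    moreover have "f A J = g A J" using insert by auto
    ultimately show ?case by simp
  qed
qed

text \<open>
  Read from left to right, the splitting law moves an element out of \<open>A\<close>.
\<close>

lemma splitting_eqI_no_free:
  assumes U: "finite U" and f: "splitting U f" and g: "splitting U g"
    and eq: "\<And>J. J \<subseteq> U \<Longrightarrow> f {} J = g {} J"
    and A: "A \<subseteq> U" and J: "J \<subseteq> U" "A \<inter> J = {}"
  shows "f A J = g A J"
proof -
  have "finite A" using A U finite_subset by blast
  then show ?thesis using A J
  proof (induction A arbitrary: J)
    case empty
    then show ?case by (simp add: eq)
  next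
    case (insert i A)
    have "f A J = g A J" "f A (insert i J) = g A (insert i J)"
      using insert by auto
    then show ?case
      using insert.prems insert.hyps
        splittingD[OF f, of i A J] splittingD[OF g, of i A J] by auto
  qed
qed

section \<open>Determinants with mixed rows\<close>

definition mixed_mat :: "nat \<Rightarrow> 'a :: comm_ring_1 mat \<Rightarrow> nat set \<Rightarrow> nat set \<Rightarrow> 'a mat" where
  "mixed_mat N K A J = mat N N (\<lambda>(i, j).
     if i \<in> J then of_bool (i = j) - K $$ (i, j)
     else if i \<in> A then of_bool (i = j) else K $$ (i, j))"

lemma det_additive_in_row:
  fixes A B C :: "'a :: comm_ring_1 mat"
  assumes carrier: "A \<in> carrier_mat n n" "B \<in> carrier_mat n n" "C \<in> carrier_mat n n"
    and k: "k < n"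
    and row: "\<And>j. j < n \<Longrightarrow> A $$ (k, j) = B $$ (k, j) + C $$ (k, j)"
    and others: "\<And>i j. i < n \<Longrightarrow> j < n \<Longrightarrow> i \<noteq> k \<Longrightarrow>
      B $$ (i, j) = A $$ (i, j) \<and> C $$ (i, j) = A $$ (i, j)"
  shows "det A = det B + det C"
proof -
  have "signof p * (\<Prod>i = 0..<n. A $$ (i, p i)) =
      signof p * (\<Prod>i = 0..<n. B $$ (i, p i)) + signof p * (\<Prod>i = 0..<n. C $$ (i, p i))"
    if "p permutes {0..<n}" for p
  proof -
    have lt: "p i < n" if "i < n" for i
      using permutes_in_image[OF \<open>p permutes {0..<n}\<close>, of i] that by simp
    have split: "(\<Prod>i = 0..<n. M $$ (i, p i)) =
        M $$ (k, p k) * (\<Prod>i\<in>{0..<n} - {k}. M $$ (i, p i))" for M :: "'a mat"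
      using k by (intro prod.remove) auto
    have "(\<Prod>i\<in>{0..<n} - {k}. B $$ (i, p i)) = (\<Prod>i\<in>{0..<n} - {k}. A $$ (i, p i))"
      "(\<Prod>i\<in>{0..<n} - {k}. C $$ (i, p i)) = (\<Prod>i\<in>{0..<n} - {k}. A $$ (i, p i))"
      using others lt by (auto intro!: prod.cong)
    then show ?thesis
      unfolding split using row[OF lt[OF k]] by (simp add: algebra_simps)
  qed
  then show ?thesis
    by (simp add: det_def'[OF carrier(1)] det_def'[OF carrier(2)] det_def'[OF carrier(3)]
        sum.distrib)
qed

lemma splitting_det_mixed_mat:
  "splitting {0..<N} (\<lambda>A J. det (mixed_mat N K A J))"
  unfolding splitting_def
proof (intro allI impI)
  fix A J i
  assume "insert i (A \<union> J) \<subseteq> {0..<N} \<and> i \<notin> A \<union> J \<and> A \<inter> J = {}"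
  then show "det (mixed_mat N K (insert i A) J) =
      det (mixed_mat N K A J) + det (mixed_mat N K A (insert i J))"
    by (intro det_additive_in_row[where k = i]) (auto simp: mixed_mat_def)
qed

lemma det_mixed_mat_no_avoided:
  assumes "K \<in> carrier_mat N N" "A \<subseteq> {0..<N}"
  shows "det (mixed_mat N K A {}) = det (submatrix K ({0..<N} - A) ({0..<N} - A))"
proof -
  have "mixed_mat N K A {} =
      mat N N (\<lambda>(i, j). if i \<in> {0..<N} - A then K $$ (i, j) else of_bool (i = j))"
    unfolding mixed_mat_def by (rule eq_matI) auto
  then show ?thesis
    using assms det_unit_rows_eq_principal_minor[of K N "{0..<N} - A"] by simp
qed

text \<open>
  The rows \<open>e\<^sub>i - K\<^sub>i\<close> are the negated rows of \<open>K - 1\<^sub>J\<close> with index in \<open>J\<close>, which gives the sign.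
\<close>

lemma det_mixed_mat_no_free:
  assumes K: "K \<in> carrier_mat N N" and J: "J \<subseteq> {0..<N}"
  shows "det (mixed_mat N K {} J) = (-1) ^ card J * det (K - diag_ind N J)"
proof -
  let ?c = "\<lambda>i. if i \<in> J then - 1 else 1 :: real"
  have carrier: "K - diag_ind N J \<in> carrier_mat N N"
    using K by (intro carrier_matI) (simp_all add: diag_ind_def)
  have "mixed_mat N K {} J = mat\<^sub>r N N (\<lambda>i. ?c i \<cdot>\<^sub>v row (K - diag_ind N J) i)"
    using K by (intro eq_matI) (auto simp: mixed_mat_def diag_ind_def)
  then have "det (mixed_mat N K {} J) = 
      prod ?c {0..<N} * det (mat\<^sub>r N N (\<lambda>i. row (K - diag_ind N J) i))"
    using carrier by (simp only:) (intro det_rows_mul, auto)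
  also have "mat\<^sub>r N N (\<lambda>i. row (K - diag_ind N J) i) = K - diag_ind N J"
    using carrier by (intro eq_matI) (simp_all del: index_minus_mat)
  also have "prod ?c {0..<N} = (-1) ^ card J"
  proof -
    have "{0..<N} \<inter> J = J" using J by blast
    then show ?thesis by (simp add: prod.If_cases)
  qed
  finally show ?thesis .
qed

section \<open>The law of a random set\<close>

definition pattern_measure ::
  "'i set \<Rightarrow> 'a measure \<Rightarrow> ('a \<Rightarrow> 'i set) \<Rightarrow> 'i set \<Rightarrow> 'i set \<Rightarrow> real" where
  "pattern_measure U M Y A J = measure M {\<omega> \<in> space M. U - A - J \<subseteq> Y \<omega> \<and> Y \<omega> \<subseteq> U - J}"

text \<open>
  The total mass is left open, because it is by this very law that the mass of the measure built
  from the determinants turns out to be \<open>1\<close>.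
\<close>

lemma splitting_pattern_measure:
  assumes "finite_measure M" and Y: "Y \<in> measurable M (count_space (Pow U))"
  shows "splitting U (pattern_measure U M Y)"
  unfolding splitting_def
proof (intro allI impI)
  interpret finite_measure M by fact
  have meas: "{\<omega> \<in> space M. P (Y \<omega>)} \<in> sets M" for P
  proof -
    have "Y -` {S \<in> Pow U. P S} \<inter> space M = {\<omega> \<in> space M. P (Y \<omega>)}"
      using measurable_space[OF Y] by auto
    then show ?thesis
      using measurable_sets[OF Y, of "{S \<in> Pow U. P S}"] by auto
  qed
  let ?P = "\<lambda>A J S. U - A - J \<subseteq> S \<and> S \<subseteq> U - J"
  let ?E = "\<lambda>A J. {\<omega> \<in> space M. ?P A J (Y \<omega>)}"
  fix A J i
  assume "insert i (A \<union> J) \<subseteq> U \<and> i \<notin> A \<union> J \<and> A \<inter> J = {}"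
  then have i: "i \<in> U" "i \<notin> A" "i \<notin> J" by auto
  have present: "?P A J S \<longleftrightarrow> ?P (insert i A) J S \<and> i \<in> S" for S
    using i by auto
  have absent: "?P A (insert i J) S \<longleftrightarrow> ?P (insert i A) J S \<and> i \<notin> S" for S
    using i by auto
  have "?E (insert i A) J = ?E A J \<union> ?E A (insert i J)"
    and "?E A J \<inter> ?E A (insert i J) = {}"
    unfolding present absent by blast+
  then show "pattern_measure U M Y (insert i A) J =
      pattern_measure U M Y A J + pattern_measure U M Y A (insert i J)"
    unfolding pattern_measure_def
    using finite_measure_Union[OF meas[of "?P A J"] meas[of "?P A (insert i J)"]] by simp
qed

lemma is_dpp_iff_pattern_measure:
  assumes K: "K \<in> carrier_mat N N" and M: "finite_measure M"
    and Y: "Y \<in> measurable M (count_space (Pow {0..<N}))"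
  shows "is_dpp N K M Y \<longleftrightarrow>
    (\<forall>A \<subseteq> {0..<N}. det (mixed_mat N K A {}) = pattern_measure {0..<N} M Y A {})"
proof -
  let ?U = "{0..<N}"
  let ?incl = "\<lambda>S. measure M {\<omega> \<in> space M. S \<subseteq> Y \<omega>} = det (submatrix K S S)"
  interpret finite_measure M by (rule M)
  have "{\<omega> \<in> space M. ?U - A - {} \<subseteq> Y \<omega> \<and> Y \<omega> \<subseteq> ?U - {}} =
      {\<omega> \<in> space M. ?U - A \<subseteq> Y \<omega>}" for A
    using measurable_space[OF Y] by auto
  then have "(\<forall>A \<subseteq> ?U. det (mixed_mat N K A {}) = pattern_measure ?U M Y A {}) \<longleftrightarrow>
      (\<forall>A \<subseteq> ?U. ?incl (?U - A))"
    using det_mixed_mat_no_avoided[OF K] by (auto simp: pattern_measure_def)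
  also have "\<dots> \<longleftrightarrow> (\<forall>S \<subseteq> ?U. ?incl S)"
  proof
    assume free: "\<forall>A \<subseteq> ?U. ?incl (?U - A)"
    show "\<forall>S \<subseteq> ?U. ?incl S"
    proof (intro allI impI)
      fix S assume "S \<subseteq> ?U"
      then have "?U - (?U - S) = S" by blast
      then show "?incl S" using free[rule_format, of "?U - S"] by simp
    qed
  qed simp
  also have "\<dots> \<longleftrightarrow> is_dpp N K M Y"
  proof
    assume incl: "\<forall>S \<subseteq> ?U. ?incl S"
    then have "measure M (space M) = 1"
      using det_submatrix_empty[of K] by (auto dest: spec[of _ "{}"])
    then have "prob_space M"
      by (intro prob_spaceI) (simp add: emeasure_eq_measure)
    then show "is_dpp N K M Y"
      using incl Y by (simp add: is_dpp_def)
  qed (simp add: is_dpp_def)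
  finally show ?thesis by simp
qed

theorem proposition2:
  fixes K :: "real mat" and N :: nat
  assumes "K \<in> carrier_mat N N"
  shows "admissible N K \<longleftrightarrow>
    (\<forall>J \<subseteq> {0..<N}. (-1) ^ card J * det (K - diag_ind N J) \<ge> 0)"
proof
  let ?U = "{0..<N}"
  assume "admissible N K"
  then obtain M :: "nat set measure" and Y where dpp: "is_dpp N K M Y"
    by (auto simp: admissible_def)
  then have M: "finite_measure M" and Y: "Y \<in> measurable M (count_space (Pow ?U))"
    by (simp_all add: is_dpp_def prob_space.axioms(1))
  have eq: "det (mixed_mat N K A {}) = pattern_measure ?U M Y A {}" if "A \<subseteq> ?U" for A
    using dpp that is_dpp_iff_pattern_measure[OF assms M Y] by blast
  show "\<forall>J \<subseteq> ?U. (-1) ^ card J * det (K - diag_ind N J) \<ge> 0"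
  proof (intro allI impI)
    fix J assume J: "J \<subseteq> ?U"
    have "det (mixed_mat N K {} J) = pattern_measure ?U M Y {} J"
      using splitting_eqI_no_avoided[OF _ splitting_det_mixed_mat
          splitting_pattern_measure[OF M Y] eq, of "{}" J] J by simp
    also have "\<dots> \<ge> 0"
      by (simp add: pattern_measure_def)
    finally show "(-1) ^ card J * det (K - diag_ind N J) \<ge> 0"
      by (simp add: det_mixed_mat_no_free[OF assms J])
  qed
next
  let ?U = "{0..<N}"
  assume nonneg: "\<forall>J \<subseteq> ?U. (-1) ^ card J * det (K - diag_ind N J) \<ge> 0"
  \<comment> \<open>The candidate probability of \<open>Y = S\<close>, by the pattern in which every index of \<open>S\<close> is required
    and every other index is avoided.\<close>
  define q where "q S = det (mixed_mat N K {} (?U - S))" for S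
  define M where "M = point_measure (Pow ?U) q"
  have q: "q S \<ge> 0" for S
    using nonneg det_mixed_mat_no_free[OF assms, of "?U - S"] by (simp add: q_def)
  have M: "finite_measure M"
    by (intro finite_measureI)
      (simp add: M_def space_point_measure emeasure_point_measure_finite)
  have Y: "(\<lambda>\<omega>. \<omega>) \<in> measurable M (count_space (Pow ?U))"
    by (simp add: M_def)
  have eq: "det (mixed_mat N K {} J) = pattern_measure ?U M (\<lambda>\<omega>. \<omega>) {} J" if "J \<subseteq> ?U" for J
  proof -
    have "{\<omega> \<in> space M. ?U - {} - J \<subseteq> \<omega> \<and> \<omega> \<subseteq> ?U - J} = {?U - J}"
      by (auto simp: M_def space_point_measure)
    moreover have "measure M {?U - J} = q (?U - J)"
      using q by (simp add: M_def measure_point_measure_finite_if)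
    moreover have "?U - (?U - J) = J" using that by auto
    ultimately show ?thesis by (simp add: q_def pattern_measure_def)
  qed
  have "det (mixed_mat N K A {}) = pattern_measure ?U M (\<lambda>\<omega>. \<omega>) A {}" if "A \<subseteq> ?U" for A
    using splitting_eqI_no_free[OF _ splitting_det_mixed_mat
        splitting_pattern_measure[OF M Y] eq, of A "{}"] that by simp
  then have "is_dpp N K M (\<lambda>\<omega>. \<omega>)"
    using is_dpp_iff_pattern_measure[OF assms M Y] by blast
  then show "admissible N K"
    unfolding admissible_def by blast
qed

end
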